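(* Let $n \ge 1$ and let $X_1, \dots, X_n$ be independent real-valued random variables supported on $[0,1]$, with $\mu_i = \mathbb{E}[X_i]$ for every $i$. Then for every real $\varepsilon \geq 0$, $$\mathbb{P}\left[\sum_{i=1}^n (X_i - \mu_i) \geq \varepsilon n\right] \leq e^{1-\varepsilon^2 n/64}.$$
   Context: "Supported on $[0,1]$" means the random variable takes values in $[0,1]$ (almost surely). *)

theory Defs
  imports "HOL-Probability.Probability"
begin

end

theory Submission
  imports Defs
begin

text \<open>This is a weakened form of Hoeffding's inequality: for independent variables with values
  in intervals of length 1, a deviation \<open>t = \<epsilon> * real n\<close> of the sum above its
  mean has probability at most \<open>exp (- 2 * t\<^sup>2 / real n)\<close>, that is
  \<open>exp (- 2 * \<epsilon>\<^sup>2 * real n)\<close>. This is already below the claimed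
  bound.\<close>

theorem theorem2p6:
  fixes M :: "'a measure" and X :: "nat \<Rightarrow> 'a \<Rightarrow> real" and \<mu> :: "nat \<Rightarrow> real"
    and n :: nat and \<epsilon> :: real
  assumes "prob_space M"
    and "n \<ge> 1"
    and "prob_space.indep_vars M (\<lambda>_. borel) X {1..n}"
    and "\<And>i. i \<in> {1..n} \<Longrightarrow> AE \<omega> in M. X i \<omega> \<in> {0..1}"
    and "\<And>i. i \<in> {1..n} \<Longrightarrow> \<mu> i = prob_space.expectation M (X i)"
    and "\<epsilon> \<ge> 0"
  shows "prob_space.prob M {\<omega> \<in> space M. (\<Sum>i=1..n. (X i \<omega> - \<mu> i)) \<ge> \<epsilon> * real n}
           \<le> exp (1 - \<epsilon>\<^sup>2 * real n / 64)"
proof -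
  interpret prob_space M by fact
  interpret Hoeffding_ineq M "{1..n}" X "\<lambda>_. 0" "\<lambda>_. 1" "\<Sum>i=1..n. expectation (X i)"
    by unfold_locales (use assms(3,4) in auto)
  have "{\<omega> \<in> space M. (\<Sum>i=1..n. (X i \<omega> - \<mu> i)) \<ge> \<epsilon> * real n} =
      {\<omega> \<in> space M. (\<Sum>i=1..n. X i \<omega>) \<ge> (\<Sum>i=1..n. expectation (X i)) + \<epsilon> * real n}"
    using assms(5) by (auto simp: sum_subtractf algebra_simps)
  \<comment> \<open>The denominator is the sum of the squared interval lengths
    \<open>(1 - 0)\<^sup>2\<close> over \<open>n\<close> indices; \<open>n \<ge> 1\<close> makes it
    positive, as Hoeffding's inequality demands.\<close>
  also have "prob \<dots> \<le> exp (- 2 * (\<epsilon> * real n)\<^sup>2 / real n)"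
    using Hoeffding_ineq_ge[of "\<epsilon> * real n"] assms(2,6) by simp
  also have "- 2 * (\<epsilon> * real n)\<^sup>2 / real n = - 2 * (\<epsilon>\<^sup>2 * real n)"
    using assms(2) by (simp add: power2_eq_square)
  \<comment> \<open>With \<open>s = \<epsilon>\<^sup>2 * real n \<ge> 0\<close>, the exponents
    compare linearly: \<open>- 2 * s \<le> - s / 64 \<le> 1 - s / 64\<close>.\<close>
  also have "exp \<dots> \<le> exp (1 - \<epsilon>\<^sup>2 * real n / 64)"
  proof -
    have "0 \<le> \<epsilon>\<^sup>2 * real n" by simp
    then show ?thesis unfolding exp_le_cancel_iff by linarith
  qed
  finally show ?thesis .
qed

end
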